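(* Let $A$ and $B$ be unital complex Banach algebras, and let $\mathfrak{A}$ and $\mathfrak{B}$ be open subgroups of the groups of invertible elements $A^{-1}$ and $B^{-1}$ respectively. Suppose that $T:\mathfrak{A}\to\mathfrak{B}$ is a surjective isometry, i.e. $T$ is surjective and $\|T(a)-T(b)\|=\|a-b\|$ for all $a,b\in\mathfrak{A}$. Then there exist a surjective real-linear isometry $\tilde T_0:A\to B$ and an element $u_0\in\mathrm{rad}(B)$ such that $T(a)=\tilde T_0(a)+u_0$ for every $a\in\mathfrak{A}$.
   Context: $A^{-1}$ denotes the multiplicative group of all invertible elements of a unital Banach algebra $A$, with the topology and metric induced by the norm of $A$; an open subgroup of $A^{-1}$ is a subgroup that is open in the norm topology. $\mathrm{rad}(B)$ is the (Jacobson) radical of $B$. Unital Banach algebras are complex, have submultiplicative norm, and the unit has norm $1$. The map $T$ is not assumed to be linear or multiplicative. *)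

theory Defs
  imports "HOL-Analysis.Analysis"
begin

text \<open>
  Unital complex Banach algebras. Submultiplicativity and \<open>norm 1 = 1\<close> come from
  \<^class>\<open>real_normed_algebra_1\<close>, completeness from \<^class>\<open>banach\<close>. The real scalar
  multiplication of \<^class>\<open>real_vector\<close> is required to be the restriction of the complex one.
\<close>

class complex_banach_algebra_1 = real_normed_algebra_1 + banach +
  fixes scaleC :: "complex \<Rightarrow> 'a \<Rightarrow> 'a" (infixr "*\<^sub>C" 75)
  assumes scaleC_add_right: "c *\<^sub>C (x + y) = c *\<^sub>C x + c *\<^sub>C y"
    and scaleC_add_left: "(c + d) *\<^sub>C x = c *\<^sub>C x + d *\<^sub>C x"
    and scaleC_scaleC: "c *\<^sub>C (d *\<^sub>C x) = (c * d) *\<^sub>C x"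
    and scaleR_scaleC: "r *\<^sub>R x = complex_of_real r *\<^sub>C x"
    and mult_scaleC_left: "(c *\<^sub>C x) * y = c *\<^sub>C (x * y)"
    and mult_scaleC_right: "x * (c *\<^sub>C y) = c *\<^sub>C (x * y)"
    and norm_scaleC: "norm (c *\<^sub>C x) = cmod c * norm x"

instantiation complex :: complex_banach_algebra_1
begin

definition scaleC_complex :: "complex \<Rightarrow> complex \<Rightarrow> complex"
  where "scaleC_complex c z = c * z"

instance
  by standard (simp_all add: scaleC_complex_def algebra_simps scaleR_conv_of_real norm_mult)

end

definition invertibles :: "'a::monoid_mult set"
  where "invertibles = {a. \<exists>b. a * b = 1 \<and> b * a = 1}"

definition subgroup_of_invertibles :: "'a::monoid_mult set \<Rightarrow> bool"
  where "subgroup_of_invertibles G \<longleftrightarrow>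
    G \<subseteq> invertibles \<and> 1 \<in> G \<and> (\<forall>a\<in>G. \<forall>b\<in>G. a * b \<in> G) \<and>
    (\<forall>a\<in>G. \<forall>b. a * b = 1 \<and> b * a = 1 \<longrightarrow> b \<in> G)"

definition open_subgroup_of_invertibles :: "'a::real_normed_algebra_1 set \<Rightarrow> bool"
  where "open_subgroup_of_invertibles G \<longleftrightarrow>
    subgroup_of_invertibles G \<and> openin (top_of_set invertibles) G"

text \<open>
  Left ideals are ring-theoretic. In a unital algebra they are automatically closed under
  scalar multiplication, since \<open>c *\<^sub>C x = (c *\<^sub>C 1) * x\<close>.
\<close>

definition left_ideal :: "'a::ring_1 set \<Rightarrow> bool"
  where "left_ideal J \<longleftrightarrow>
    0 \<in> J \<and> (\<forall>x\<in>J. \<forall>y\<in>J. x + y \<in> J) \<and> (\<forall>r. \<forall>x\<in>J. r * x \<in> J)"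

definition maximal_left_ideal :: "'a::ring_1 set \<Rightarrow> bool"
  where "maximal_left_ideal M \<longleftrightarrow>
    left_ideal M \<and> M \<noteq> UNIV \<and> (\<forall>J. left_ideal J \<and> M \<subseteq> J \<longrightarrow> J = M \<or> J = UNIV)"

definition jacobson_radical :: "'a::ring_1 set"
  where "jacobson_radical = \<Inter>{M. maximal_left_ideal M}"

end

theory Submission imports Defs begin

text \<open>
  A surjective isometry between open sets, convex or not, satisfies the midpoint law on every
  segment in its domain (a local Mazur--Ulam theorem, lemma \<open>isometry_midpoint\<close>). In the group \<open>\<AA>\<close> there are enough segments, because for each complex
  \<open>c\<close> of modulus 1 the group contains the open convex cone spanned by the unit ball around \<open>c\<close>
  (lemma \<open>scalar_cone_subset_open_subgroup\<close>), and because it contains with \<open>a\<close> the open ray from 0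
  through \<open>a\<close>. As \<open>T\<close> is uniformly continuous and 0 is in the closure of \<open>\<AA>\<close>, the limit \<open>u\<close> of
  \<open>T\<close> at 0 exists, and it plays the part of \<open>T 0\<close>.

  On each cone \<open>T - u\<close> is additive, so that it extends to a linear isometry of the whole algebra.
  Any two of the cones that are not opposite overlap, so this is one and the same map \<open>L\<close> for all \<open>c\<close>
  (lemma \<open>linear_on_cones\<close>).

  The group may be disconnected, and a point \<open>a\<close> of it far from the cones can in general not be
  joined to them by segments. Instead the distances from \<open>a\<close> to the points of the cones determine
  \<open>T a\<close>: the element \<open>b\<close> with \<open>L b = T a - u\<close> has the distance \<open>t\<close> from all \<open>a + t *\<^sub>R c *\<^sub>C 1\<close>
  with \<open>t > norm a\<close> and \<open>cmod c = 1\<close>, and \<open>a\<close> is the only such element because 1 is a vertex of the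
  unit ball of a complex Banach algebra (lemma \<open>unit_vertex\<close>).

  Finally, the midpoint law between 0 and \<open>a\<close> shows that \<open>\<BB>\<close> is invariant under translation by \<open>u\<close>.
  Since \<open>\<BB>\<close> is a group and every element of the algebra is a sum of two elements of \<open>\<BB>\<close>, all
  \<open>1 + b * u\<close> are invertible, which puts \<open>u\<close> into the radical
  (lemma \<open>translation_invariant_imp_radical\<close>).
\<close>

section \<open>A local Mazur--Ulam theorem\<close>

text \<open>
  Conjugating the reflection at \<open>m\<close> by a self-isometry \<open>\<phi>\<close> and composing the result with the
  reflection gives a self-isometry that displaces \<open>m\<close> twice as far as \<open>\<phi>\<close> does. Hence a self-isometry of a bounded symmetric set that moved the
  centre could be turned into self-isometries that move it arbitrarily far.
\<close>

lemma self_isometry_fixes_centre: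
  fixes m :: "'a::real_normed_vector"
  assumes bdd: "bounded X" and "m \<in> X"
    and sym: "\<And>x. x \<in> X \<Longrightarrow> 2 *\<^sub>R m - x \<in> X"
    and "bij_betw \<phi> X X"
    and "\<And>x y. x \<in> X \<Longrightarrow> y \<in> X \<Longrightarrow> dist (\<phi> x) (\<phi> y) = dist x y"
  shows "\<phi> m = m"
proof -
  obtain D where D: "\<And>x. x \<in> X \<Longrightarrow> dist m x \<le> D"
    using bdd bounded_any_center[of X m] by auto
  have doubling: "2 ^ n * dist (\<phi> m) m \<le> D"
    if "bij_betw \<phi> X X" "\<And>x y. x \<in> X \<Longrightarrow> y \<in> X \<Longrightarrow> dist (\<phi> x) (\<phi> y) = dist x y" for n \<phi>
    using that
  proof (induction n arbitrary: \<phi>)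
    case 0
    then show ?case
      using D[of "\<phi> m"] \<open>m \<in> X\<close> by (simp add: dist_commute bij_betwE)
  next
    case (Suc n)
    define \<psi> where "\<psi> x = 2 *\<^sub>R m - x" for x
    define \<theta> where "\<theta> = inv_into X \<phi>"
    have \<psi>: "bij_betw \<psi> X X"
      by (rule bij_betwI[where g = \<psi>]) (auto simp: \<psi>_def sym)
    have \<psi>_iso: "dist (\<psi> x) (\<psi> y) = dist x y" for x y
      by (simp add: \<psi>_def dist_norm norm_minus_commute)
    have \<theta>: "bij_betw \<theta> X X"
      unfolding \<theta>_def using Suc.prems(1) by (rule bij_betw_inv_into)
    have \<phi>\<theta>: "\<phi> (\<theta> x) = x" if "x \<in> X" for x
      using that Suc.prems(1) by (simp add: \<theta>_def bij_betw_inv_into_right)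
    have \<theta>_iso: "dist (\<theta> x) (\<theta> y) = dist x y" if "x \<in> X" "y \<in> X" for x y
      using that Suc.prems(2)[of "\<theta> x" "\<theta> y"] \<theta> by (simp add: \<phi>\<theta> bij_betwE)
    define \<phi>' where "\<phi>' = \<psi> \<circ> \<theta> \<circ> \<psi> \<circ> \<phi>"
    have "bij_betw \<phi>' X X"
      unfolding \<phi>'_def using \<psi> \<theta> Suc.prems(1) by (blast intro: bij_betw_trans)
    moreover have "dist (\<phi>' x) (\<phi>' y) = dist x y" if "x \<in> X" "y \<in> X" for x y
    proof -
      have "\<phi> x \<in> X" "\<phi> y \<in> X" using that Suc.prems(1) by (auto simp: bij_betwE)
      moreover from this have "\<psi> (\<phi> x) \<in> X" "\<psi> (\<phi> y) \<in> X" using \<psi> by (auto simp: bij_betwE)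
      ultimately show ?thesis
        using that by (simp add: \<phi>'_def \<psi>_iso \<theta>_iso Suc.prems(2))
    qed
    ultimately have "2 ^ n * dist (\<phi>' m) m \<le> D"
      by (rule Suc.IH)
    moreover have "dist (\<phi>' m) m = 2 * dist (\<phi> m) m"
    proof -
      have "\<phi> m \<in> X" using \<open>m \<in> X\<close> Suc.prems(1) by (auto simp: bij_betwE)
      then have in_X: "\<psi> (\<phi> m) \<in> X" using \<psi> by (auto simp: bij_betwE)
      have "\<psi> m = m" by (simp add: \<psi>_def scaleR_2)
      then have "dist (\<phi>' m) m = dist (\<theta> (\<psi> (\<phi> m))) m"
        using \<psi>_iso[of "\<theta> (\<psi> (\<phi> m))" m] by (simp add: \<phi>'_def)
      also have "\<dots> = dist (\<psi> (\<phi> m)) (\<phi> m)"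
        using Suc.prems(2)[of "\<theta> (\<psi> (\<phi> m))" m] in_X \<theta> \<open>m \<in> X\<close> by (simp add: \<phi>\<theta> bij_betwE)
      also have "\<dots> = norm (2 *\<^sub>R (m - \<phi> m))"
        by (simp add: \<psi>_def dist_norm algebra_simps scaleR_2)
      also have "\<dots> = 2 * dist (\<phi> m) m"
        by (simp add: dist_norm norm_minus_commute)
      finally show ?thesis .
    qed
    ultimately show ?case by (simp add: mult_ac)
  qed
  show ?thesis
  proof (rule ccontr)
    assume "\<phi> m \<noteq> m"
    then have pos: "dist (\<phi> m) m > 0" by simp
    obtain n where "D / dist (\<phi> m) m < 2 ^ n"
      using real_arch_pow[of 2] by auto
    then have "D < 2 ^ n * dist (\<phi> m) m" using pos by (simp add: field_simps)
    then show False using doubling[OF assms(4,5), of n] by simp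
  qed
qed

text \<open>The reflection of the image at \<open>m'\<close>, pulled back by \<open>T\<close>, is a self-isometry \<open>R\<close> of \<open>X\<close> and so
  fixes \<open>m\<close>. Hence \<open>T m\<close> is a fixed point of the reflection at \<open>m'\<close>.\<close>

lemma isometry_maps_centre_to_centre:
  fixes m :: "'a::real_normed_vector" and m' :: "'b::real_normed_vector"
  assumes "bounded X" and "m \<in> X" and sym: "\<And>x. x \<in> X \<Longrightarrow> 2 *\<^sub>R m - x \<in> X"
    and sym': "\<And>y. y \<in> T ` X \<Longrightarrow> 2 *\<^sub>R m' - y \<in> T ` X"
    and iso: "\<And>x y. x \<in> X \<Longrightarrow> y \<in> X \<Longrightarrow> dist (T x) (T y) = dist x y"
  shows "T m = m'"
proof -
  have inj: "inj_on T X"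
    by (rule inj_onI) (metis iso dist_eq_0_iff)
  define R where "R x = inv_into X T (2 *\<^sub>R m' - T x)" for x
  have R: "R x \<in> X" "T (R x) = 2 *\<^sub>R m' - T x" if "x \<in> X" for x
    using that sym'[of "T x"] by (auto simp: R_def inv_into_into f_inv_into_f)
  have RR: "R (R x) = x" if "x \<in> X" for x
    using that R inj by (simp add: R_def)
  have "dist (R x) (R y) = dist x y" if "x \<in> X" "y \<in> X" for x y
    using that R iso[of "R x" "R y"] iso[of x y] by (simp add: dist_norm norm_minus_commute)
  moreover have "bij_betw R X X"
    by (rule bij_betwI[where g = R]) (auto simp: R RR)
  ultimately have "R m = m"
    using assms(1,2) sym by (intro self_isometry_fixes_centre[of X m R]) auto
  then have "T m = 2 *\<^sub>R m' - T m" using R(2)[OF \<open>m \<in> X\<close>] by simp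
  then have "2 *\<^sub>R T m = 2 *\<^sub>R m'" by (simp add: scaleR_2 algebra_simps)
  then show ?thesis by simp
qed

text \<open>
  The points halfway between \<open>f\<close> and \<open>g\<close> in the metric sense form a bounded set with centre
  \<open>midpoint f g\<close>, and an isometry respects this set as soon as it is contained in the domain and
  its counterpart in the range; for this it suffices that two balls are.
\<close>

lemma isometry_midpoint_local:
  fixes T :: "'a::real_normed_vector \<Rightarrow> 'b::real_normed_vector"
  assumes iso: "\<And>x y. x \<in> U \<Longrightarrow> y \<in> U \<Longrightarrow> dist (T x) (T y) = dist x y"
    and "f \<in> U" "g \<in> U"
    and ballU: "cball f (dist f g / 2) \<subseteq> U"
    and ballV: "cball (T f) (dist f g / 2) \<subseteq> T ` U"
  shows "T (midpoint f g) = midpoint (T f) (T g)"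
proof -
  define d where "d = dist f g / 2"
  define X where "X = {x. dist f x = d \<and> dist g x = d}"
  have XU: "X \<subseteq> U" using ballU by (auto simp: X_def d_def)
  have TX: "T ` X = {y. dist (T f) y = d \<and> dist (T g) y = d}"
  proof safe
    fix x assume "x \<in> X"
    then show "dist (T f) (T x) = d" "dist (T g) (T x) = d"
      using iso XU assms(2,3) by (auto simp: X_def)
  next
    fix y assume y: "d = dist (T f) y" "dist (T g) y = dist (T f) y"
    then have "y \<in> T ` U" using ballV by (auto simp: d_def)
    then obtain x where "x \<in> U" "y = T x" by auto
    then show "y \<in> T ` X" using y iso assms(2,3) by (auto simp: X_def)
  qed
  have refl: "dist a (2 *\<^sub>R midpoint a b - x) = dist b x"
    "dist b (2 *\<^sub>R midpoint a b - x) = dist a x" for a b x :: "'c::real_normed_vector"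
    by (simp_all add: midpoint_def dist_norm norm_minus_commute)
  show ?thesis
  proof (rule isometry_maps_centre_to_centre[where X = X])
    have "X \<subseteq> cball f d" by (auto simp: X_def)
    then show "bounded X" using bounded_cball bounded_subset by blast
    show "midpoint f g \<in> X"
      by (simp add: X_def d_def dist_midpoint)
    show "2 *\<^sub>R midpoint f g - x \<in> X" if "x \<in> X" for x
      using that by (simp add: X_def refl)
    show "2 *\<^sub>R midpoint (T f) (T g) - y \<in> T ` X" if "y \<in> T ` X" for y
      using that unfolding TX by (simp add: refl)
  qed (use XU iso in auto)
qed

lemma two_midpoint: "2 *\<^sub>R midpoint x y = x + y"
  for x y :: "'a::real_normed_vector"
  by (simp add: midpoint_def)

text \<open>
  Along a compact segment the local law holds for all pairs of points at distance at most some
  \<open>\<rho>\<close>; it spreads to longer segments by doubling: the midpoint law for the two halves and for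
  the segment between the two quarter points implies that for the whole segment.
\<close>

lemma isometry_midpoint:
  fixes T :: "'a::real_normed_vector \<Rightarrow> 'b::real_normed_vector"
  assumes "open U" "open (T ` U)"
    and iso: "\<And>x y. x \<in> U \<Longrightarrow> y \<in> U \<Longrightarrow> dist (T x) (T y) = dist x y"
    and seg: "closed_segment f g \<subseteq> U"
  shows "T (midpoint f g) = midpoint (T f) (T g)"
proof -
  let ?S = "closed_segment f g"
  have "continuous_on U T"
    unfolding continuous_on_iff using iso by metis
  then have "compact (T ` ?S)"
    using seg by (intro compact_continuous_image) (auto intro: continuous_on_subset)
  then obtain \<rho>2 where \<rho>2: "\<rho>2 > 0" "(\<Union>x\<in>T ` ?S. cball x \<rho>2) \<subseteq> T ` U"
    using compact_subset_open_imp_cball_epsilon_subset[of "T ` ?S" "T ` U"] seg assms(2) by blast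
  obtain \<rho>1 where \<rho>1: "\<rho>1 > 0" "(\<Union>x\<in>?S. cball x \<rho>1) \<subseteq> U"
    using compact_subset_open_imp_cball_epsilon_subset[of ?S U] seg assms(1) compact_segment by blast
  define \<rho> where "\<rho> = min \<rho>1 \<rho>2"
  have "\<rho> > 0" using \<rho>1 \<rho>2 by (simp add: \<rho>_def)
  have law: "T (midpoint p q) = midpoint (T p) (T q)"
    if "p \<in> ?S" "q \<in> ?S" "dist p q \<le> 2 ^ n * \<rho>" for p q n
    using that
  proof (induction n arbitrary: p q)
    case 0
    then have le: "dist p q / 2 \<le> \<rho>1" "dist p q / 2 \<le> \<rho>2"
      using \<open>\<rho> > 0\<close> by (simp_all add: \<rho>_def)
    show ?case
    proof (rule isometry_midpoint_local[where U = U])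
      show "dist (T x) (T y) = dist x y" if "x \<in> U" "y \<in> U" for x y using that by (rule iso)
      show "p \<in> U" "q \<in> U" using 0 seg by blast+
      have "cball p (dist p q / 2) \<subseteq> cball p \<rho>1" using le by (simp add: subset_cball)
      also have "\<dots> \<subseteq> U" using \<rho>1(2) 0(1) by blast
      finally show "cball p (dist p q / 2) \<subseteq> U" .
      have "cball (T p) (dist p q / 2) \<subseteq> cball (T p) \<rho>2" using le by (simp add: subset_cball)
      also have "\<dots> \<subseteq> T ` U" using \<rho>2(2) 0(1) by blast
      finally show "cball (T p) (dist p q / 2) \<subseteq> T ` U" .
    qed
  next
    case (Suc n)
    define m where "m = midpoint p q"
    define a where "a = midpoint p m"
    define b where "b = midpoint m q"
    have "closed_segment p q \<subseteq> ?S"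
      using Suc.prems by (simp add: closed_segment_subset)
    then have mS: "m \<in> ?S" unfolding m_def using midpoint_in_closed_segment by blast
    then have "closed_segment p m \<subseteq> ?S" "closed_segment m q \<subseteq> ?S"
      using Suc.prems by (simp_all add: closed_segment_subset)
    then have abS: "a \<in> ?S" "b \<in> ?S"
      unfolding a_def b_def using midpoint_in_closed_segment by blast+
    have half: "dist p q / 2 \<le> 2 ^ n * \<rho>" using Suc.prems by simp
    have "dist p m \<le> 2 ^ n * \<rho>" "dist m q \<le> 2 ^ n * \<rho>"
      using half unfolding m_def by (simp_all add: dist_midpoint)
    moreover have "dist a b \<le> 2 ^ n * \<rho>"
    proof -
      have "a - b = (1/2) *\<^sub>R (p - q)"
        by (simp add: a_def b_def midpoint_def algebra_simps)
      then show ?thesis using half by (simp add: dist_norm)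
    qed
    moreover have "midpoint a b = m"
    proof -
      have "2 *\<^sub>R (2 *\<^sub>R midpoint a b) = 2 *\<^sub>R a + 2 *\<^sub>R b"
        by (simp only: two_midpoint scaleR_add_right)
      also have "\<dots> = (p + q) + (m + m)" by (simp only: a_def b_def two_midpoint ac_simps)
      also have "p + q = 2 *\<^sub>R m" by (simp only: m_def two_midpoint)
      also have "2 *\<^sub>R m + (m + m) = 2 *\<^sub>R (2 *\<^sub>R m)" by (simp only: scaleR_2)
      finally show ?thesis by simp
    qed
    ultimately have laws: "T a = midpoint (T p) (T m)" "T b = midpoint (T m) (T q)"
      "T m = midpoint (T a) (T b)"
      using Suc.IH[of p m] Suc.IH[of m q] Suc.IH[of a b] Suc.prems mS abS
      by (simp_all add: a_def b_def)
    have TaTb: "2 *\<^sub>R T a = T p + T m" "2 *\<^sub>R T b = T m + T q"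
      unfolding laws(1,2) by (rule two_midpoint)+
    have Tm: "2 *\<^sub>R T m = T a + T b"
      by (subst laws(3)) (rule two_midpoint)
    have "2 *\<^sub>R T m + 2 *\<^sub>R T m = (T a + T b) + (T a + T b)" by (simp only: Tm)
    also have "\<dots> = 2 *\<^sub>R T a + 2 *\<^sub>R T b" by (simp only: scaleR_2 ac_simps)
    finally have "2 *\<^sub>R T m + 2 *\<^sub>R T m = (T p + T m) + (T m + T q)" by (simp only: TaTb)
    then have "(T m + T m) + 2 *\<^sub>R T m = (T m + T m) + (T p + T q)"
      by (simp only: scaleR_2 ac_simps)
    then have "2 *\<^sub>R T m = 2 *\<^sub>R midpoint (T p) (T q)"
      by (simp only: add_left_cancel two_midpoint)
    then show ?case by (simp add: m_def)
  qed
  obtain n where "dist f g / \<rho> < 2 ^ n"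
    using real_arch_pow[of 2] by auto
  then have "dist f g \<le> 2 ^ n * \<rho>" using \<open>\<rho> > 0\<close> by (simp add: field_simps)
  then show ?thesis by (intro law[where n = n]) auto
qed

section \<open>Open subgroups of the group of invertible elements\<close>

lemma invertiblesI: "a * b = 1 \<Longrightarrow> b * a = 1 \<Longrightarrow> a \<in> invertibles"
  by (auto simp: invertibles_def)

lemma invertibles_mult:
  assumes "a \<in> invertibles" "b \<in> invertibles"
  shows "a * b \<in> invertibles"
proof -
  obtain a' b' where "a * a' = 1" "a' * a = 1" "b * b' = 1" "b' * b = 1"
    using assms by (auto simp: invertibles_def)
  then have "a * b * (b' * a') = 1" "b' * a' * (a * b) = 1"
    by (metis mult.assoc mult_1_right)+
  then show ?thesis by (rule invertiblesI)
qed

text \<open>The inverse is given by the Neumann series.\<close>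

lemma invertible_if_near_1:
  fixes x :: "'a::{real_normed_algebra_1, banach}"
  assumes "norm (1 - x) < 1"
  shows "x \<in> invertibles"
proof -
  define y where "y = 1 - x"
  have x: "x = 1 - y" by (simp add: y_def)
  have sm: "summable (\<lambda>n. y ^ n)"
    using assms by (simp add: y_def complete_algebra_summable_geometric)
  then have lim: "(\<lambda>n. y ^ n) \<longlonglongrightarrow> 0" by (rule summable_LIMSEQ_zero)
  let ?s = "\<lambda>n. \<Sum>i<n. y ^ i"
  have "?s \<longlonglongrightarrow> suminf (\<lambda>n. y ^ n)" using sm by (rule summable_LIMSEQ)
  then have l: "(\<lambda>n. x * ?s n) \<longlonglongrightarrow> x * suminf (\<lambda>n. y ^ n)"
    "(\<lambda>n. ?s n * x) \<longlonglongrightarrow> suminf (\<lambda>n. y ^ n) * x"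
    by (auto intro: tendsto_mult_left tendsto_mult_right)
  have "x * y ^ n = y ^ n - y ^ Suc n" "y ^ n * x = y ^ n - y ^ Suc n" for n
    by (simp_all add: x left_diff_distrib right_diff_distrib power_commutes)
  then have "x * ?s n = 1 - y ^ n" "?s n * x = 1 - y ^ n" for n
    by (induction n) (simp_all add: distrib_left distrib_right)
  moreover have "(\<lambda>n. 1 - y ^ n) \<longlonglongrightarrow> 1" using tendsto_diff[OF tendsto_const lim, of 1] by simp
  ultimately have "x * suminf (\<lambda>n. y ^ n) = 1" "suminf (\<lambda>n. y ^ n) * x = 1"
    using l by (auto dest: LIMSEQ_unique)
  then show ?thesis by (rule invertiblesI)
qed

lemma open_invertibles: "open (invertibles :: 'a::{real_normed_algebra_1, banach} set)"
  unfolding open_dist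
proof (intro ballI)
  fix x :: 'a assume x: "x \<in> invertibles"
  then obtain x' where x': "x * x' = 1" "x' * x = 1" by (auto simp: invertibles_def)
  have "x' \<noteq> 0" using x' by auto
  show "\<exists>e>0. \<forall>y. dist y x < e \<longrightarrow> y \<in> invertibles"
  proof (intro exI[of _ "1 / norm x'"] conjI allI impI)
    show "0 < 1 / norm x'" using \<open>x' \<noteq> 0\<close> by simp
    fix y assume y: "dist y x < 1 / norm x'"
    have "norm (1 - x' * y) = norm (x' * (x - y))" using x' by (simp add: algebra_simps)
    also have "\<dots> \<le> norm x' * norm (x - y)" by (rule norm_mult_ineq)
    also have "\<dots> < 1" using y \<open>x' \<noteq> 0\<close> by (simp add: dist_norm norm_minus_commute field_simps)
    finally have "x * (x' * y) \<in> invertibles"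
      by (intro invertibles_mult x invertible_if_near_1)
    then show "y \<in> invertibles" by (simp add: x' flip: mult.assoc)
  qed
qed

lemma open_subgroup_openD:
  fixes G :: "'a::{real_normed_algebra_1, banach} set"
  assumes "open_subgroup_of_invertibles G"
  shows "open G"
  using assms openin_open_eq[OF open_invertibles] by (auto simp: open_subgroup_of_invertibles_def)

lemma subgroup_of_invertiblesD:
  assumes "subgroup_of_invertibles G"
  shows "G \<subseteq> invertibles" "1 \<in> G" "a \<in> G \<Longrightarrow> b \<in> G \<Longrightarrow> a * b \<in> G"
    and subgroup_of_invertibles_inverse: "a \<in> G \<Longrightarrow> \<exists>b\<in>G. a * b = 1 \<and> b * a = 1"
proof -
  show "a \<in> G \<Longrightarrow> \<exists>b\<in>G. a * b = 1 \<and> b * a = 1"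
    using assms unfolding subgroup_of_invertibles_def invertibles_def by blast
qed (use assms in \<open>auto simp: subgroup_of_invertibles_def\<close>)

text \<open>The cosets of an open subgroup are open, so the subgroup is also relatively closed.\<close>

lemma connected_subset_open_subgroup:
  fixes G :: "'a::{real_normed_algebra_1, banach} set"
  assumes G: "open_subgroup_of_invertibles G"
    and S: "connected S" "S \<subseteq> invertibles" and "s \<in> S" "s \<in> G"
  shows "S \<subseteq> G"
proof
  have sub: "subgroup_of_invertibles G" using G by (simp add: open_subgroup_of_invertibles_def)
  have opn: "open G" using G by (rule open_subgroup_openD)
  fix t assume "t \<in> S"
  have "(s \<in> G) = (t \<in> G)"
  proof (rule connected_local_const[OF S(1) \<open>s \<in> S\<close> \<open>t \<in> S\<close>], intro ballI)
    fix x assume "x \<in> S"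
    then obtain x' where x': "x * x' = 1" "x' * x = 1" using S by (auto simp: invertibles_def)
    have "((\<lambda>y. x' * y) \<longlongrightarrow> x' * x) (at x within S)"
      by (intro tendsto_intros)
    then have "\<forall>\<^sub>F y in at x within S. x' * y \<in> G"
      using opn subgroup_of_invertiblesD(2)[OF sub] by (auto simp: x' dest: topological_tendstoD)
    then show "\<forall>\<^sub>F y in at x within S. (x \<in> G) = (y \<in> G)"
    proof eventually_elim
      case (elim y)
      then obtain w where w: "w \<in> G" "(x' * y) * w = 1"
        using subgroup_of_invertibles_inverse[OF sub] by blast
      have y: "y = x * (x' * y)" by (simp add: x' flip: mult.assoc)
      have "y * w = x * ((x' * y) * w)" by (simp add: x' flip: mult.assoc)
      then have "x = y * w" by (simp add: w)
      then show ?case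
        using y elim w(1) subgroup_of_invertiblesD(3)[OF sub] by metis
    qed
  qed
  then show "t \<in> G" using \<open>s \<in> G\<close> by simp
qed

section \<open>Cones around the scalars\<close>

lemma scaleC_one [simp]: "1 *\<^sub>C x = x"
  for x :: "'a::complex_banach_algebra_1"
  using scaleR_scaleC[of 1 x] by simp

lemma scaleC_minus_left: "(- c) *\<^sub>C x = - (c *\<^sub>C x)"
  for x :: "'a::complex_banach_algebra_1"
proof -
  have "(- c) *\<^sub>C x = (c * complex_of_real (-1)) *\<^sub>C x" by simp
  also have "\<dots> = c *\<^sub>C ((-1) *\<^sub>R x)" by (simp only: scaleR_scaleC scaleC_scaleC)
  also have "\<dots> = (complex_of_real (-1) * c) *\<^sub>C x"
    by (simp only: scaleR_scaleC scaleC_scaleC mult.commute)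
  also have "\<dots> = - (c *\<^sub>C x)"
    by (simp only: scaleC_scaleC[symmetric] scaleR_scaleC[symmetric]) simp
  finally show ?thesis .
qed

lemma scaleC_diff_left: "(c - d) *\<^sub>C x = c *\<^sub>C x - d *\<^sub>C x"
  for x :: "'a::complex_banach_algebra_1"
  using scaleC_add_left[of c "- d" x] by (simp add: scaleC_minus_left)

lemma scaleC_diff_right: "c *\<^sub>C (x - y) = c *\<^sub>C x - c *\<^sub>C y"
  for x :: "'a::complex_banach_algebra_1"
  using scaleC_add_right[of c "x - y" y] by simp

lemma scaleC_sum_left: "(\<Sum>i\<in>I. f i) *\<^sub>C x = (\<Sum>i\<in>I. f i *\<^sub>C x)"
  for x :: "'a::complex_banach_algebra_1"
proof -
  have "0 *\<^sub>C x = 0" using scaleC_diff_left[of 0 0 x] by simp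
  then show ?thesis by (induction I rule: infinite_finite_induct) (simp_all add: scaleC_add_left)
qed

lemma scaleC_sum_right: "c *\<^sub>C (\<Sum>i\<in>I. f i) = (\<Sum>i\<in>I. c *\<^sub>C f i)"
  for f :: "_ \<Rightarrow> 'a::complex_banach_algebra_1"
proof -
  have "c *\<^sub>C 0 = (0::'a)" using scaleC_diff_right[of c 0 0] by simp
  then show ?thesis by (induction I rule: infinite_finite_induct) (simp_all add: scaleC_add_right)
qed

lemma scaleR_scaleC_left: "r *\<^sub>R (c *\<^sub>C x) = (of_real r * c) *\<^sub>C x"
  for x :: "'a::complex_banach_algebra_1"
  by (simp add: scaleR_scaleC scaleC_scaleC)

text \<open>For \<open>cmod c = 1\<close> this is the open convex cone spanned by the open unit ball around
  \<open>c\<close>. It consists of invertible elements, and every element of the algebra is a difference of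
  two of its members.\<close>

definition scalar_cone :: "complex \<Rightarrow> 'a::complex_banach_algebra_1 set"
  where "scalar_cone c = (\<Union>r\<in>{0<..}. ball (r *\<^sub>R c *\<^sub>C 1) r)"

lemma scalar_cone_iff: "x \<in> scalar_cone c \<longleftrightarrow> (\<exists>r>0. norm (x - r *\<^sub>R c *\<^sub>C 1) < r)"
  by (auto simp: scalar_cone_def dist_norm norm_minus_commute)

lemma open_scalar_cone: "open (scalar_cone c)"
  by (auto simp: scalar_cone_def)

lemma scalar_cone_add:
  assumes "x \<in> scalar_cone c" "y \<in> scalar_cone c"
  shows "x + y \<in> scalar_cone c"
proof -
  obtain r s where rs: "r > 0" "norm (x - r *\<^sub>R c *\<^sub>C 1) < r" "s > 0" "norm (y - s *\<^sub>R c *\<^sub>C 1) < s"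
    using assms by (auto simp: scalar_cone_iff)
  have "norm (x + y - (r + s) *\<^sub>R c *\<^sub>C 1) = norm ((x - r *\<^sub>R c *\<^sub>C 1) + (y - s *\<^sub>R c *\<^sub>C 1))"
    by (simp add: algebra_simps)
  also have "\<dots> < r + s" using rs norm_triangle_ineq by (smt (verit))
  finally show ?thesis using rs by (auto simp: scalar_cone_iff intro!: exI[of _ "r + s"])
qed

lemma scalar_cone_scale:
  assumes "x \<in> scalar_cone c" "t > 0"
  shows "t *\<^sub>R x \<in> scalar_cone c"
proof -
  obtain r where r: "r > 0" "norm (x - r *\<^sub>R c *\<^sub>C 1) < r"
    using assms by (auto simp: scalar_cone_iff)
  have "norm (t *\<^sub>R x - (t * r) *\<^sub>R c *\<^sub>C 1) = t * norm (x - r *\<^sub>R c *\<^sub>C 1)"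
    using assms(2) by (simp flip: scaleR_scaleR scaleR_diff_right)
  then show ?thesis using r assms(2) by (auto simp: scalar_cone_iff intro!: exI[of _ "t * r"])
qed

lemma convex_scalar_cone: "convex (scalar_cone c)"
proof (rule convexI)
  fix x y :: 'a and u v :: real
  assume "x \<in> scalar_cone c" "y \<in> scalar_cone c" "0 \<le> u" "0 \<le> v" "u + v = 1"
  then show "u *\<^sub>R x + v *\<^sub>R y \<in> scalar_cone c"
    by (cases "u = 0"; cases "v = 0") (auto intro!: scalar_cone_add scalar_cone_scale)
qed

lemma add_scalar_in_scalar_cone:
  assumes "norm a < r"
  shows "a + r *\<^sub>R c *\<^sub>C 1 \<in> scalar_cone c"
proof -
  have "0 < r" using assms norm_ge_zero[of a] by linarith
  then show ?thesis using assms by (auto simp: scalar_cone_iff)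
qed

lemma scalar_cone_1_of_real: "r > 0 \<Longrightarrow> r *\<^sub>R 1 \<in> scalar_cone 1"
  using add_scalar_in_scalar_cone[of 0 r 1] by simp

lemma scalar_cone_invertible:
  assumes "cmod c = 1"
  shows "scalar_cone c \<subseteq> invertibles"
proof
  fix x :: 'a assume "x \<in> scalar_cone c"
  then obtain r where r: "r > 0" "norm (x - r *\<^sub>R c *\<^sub>C 1) < r" by (auto simp: scalar_cone_iff)
  define k where "k = inverse (of_real r * c)"
  have "c \<noteq> 0" using assms by auto
  then have "of_real r * c \<noteq> 0" using r(1) by simp
  then have k: "k * (of_real r * c) = 1" unfolding k_def by (rule left_inverse)
  have norm_k: "cmod k = 1 / r"
    using r(1) assms by (simp add: k_def norm_inverse norm_mult divide_inverse)
  have "norm (1 - k *\<^sub>C x) = norm (k *\<^sub>C (r *\<^sub>R c *\<^sub>C 1 - x))"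
    by (simp add: scaleC_diff_right scaleR_scaleC_left scaleC_scaleC k)
  also have "\<dots> = norm (x - r *\<^sub>R c *\<^sub>C 1) / r"
    by (simp add: norm_scaleC norm_k norm_minus_commute)
  also have "\<dots> < 1" using r by simp
  finally have "k *\<^sub>C x \<in> invertibles" by (rule invertible_if_near_1)
  moreover have "(of_real r * c) *\<^sub>C (1::'a) \<in> invertibles"
    by (rule invertiblesI[of _ "k *\<^sub>C 1"])
       (simp_all add: mult_scaleC_left mult_scaleC_right scaleC_scaleC k mult_ac(2)[of _ k])
  ultimately have "(of_real r * c) *\<^sub>C 1 * (k *\<^sub>C x) \<in> invertibles" by (rule invertibles_mult[rotated])
  then show "x \<in> invertibles"
    by (simp add: mult_scaleC_left mult_scaleC_right scaleC_scaleC k mult_ac(2)[of _ k])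
qed

text \<open>Unless \<open>c' = - c\<close>, the parallelogram law gives \<open>cmod (c' - c) < 2\<close>, which puts
  \<open>c + c' = 2 * c + (c' - c)\<close> into the disc around \<open>2 * c\<close> of radius 2.\<close>

lemma scalar_in_scalar_cone:
  assumes "cmod c = 1" "cmod c' = 1" "c' \<noteq> - c"
  shows "(c + c') *\<^sub>C 1 \<in> (scalar_cone c :: 'a::complex_banach_algebra_1 set)"
proof -
  have "c + c' \<noteq> 0" using assms(3) by (metis add_eq_0_iff)
  then have "0 < cmod (c + c') ^ 2" by simp
  moreover have "cmod (c' - c) ^ 2 + cmod (c + c') ^ 2 = 2 * cmod c ^ 2 + 2 * cmod c' ^ 2"
    by (simp add: cmod_power2) (simp add: power2_eq_square algebra_simps)
  then have "cmod (c' - c) ^ 2 + cmod (c + c') ^ 2 = 2 ^ 2"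
    using assms(1,2) by simp
  ultimately have "cmod (c' - c) ^ 2 < 2 ^ 2" by linarith
  then have "cmod (c' - c) < 2" by (rule power2_less_imp_less) simp
  moreover have "(c + c') *\<^sub>C (1::'a) - 2 *\<^sub>R c *\<^sub>C 1 = (c' - c) *\<^sub>C 1"
    by (simp add: scaleR_scaleC_left flip: scaleC_diff_left)
  ultimately have "norm ((c + c') *\<^sub>C (1::'a) - 2 *\<^sub>R c *\<^sub>C 1) < 2"
    by (simp add: norm_scaleC)
  then show ?thesis by (auto simp: scalar_cone_iff intro!: exI[of _ 2])
qed

lemma scalar_cone_overlap:
  assumes "cmod c = 1" "cmod c' = 1" "c' \<noteq> - c"
  shows "scalar_cone c \<inter> scalar_cone c' \<noteq> ({} :: 'a::complex_banach_algebra_1 set)"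
proof -
  have "c \<noteq> - c'" using assms(3) by auto
  then show ?thesis
    using scalar_in_scalar_cone[OF assms] scalar_in_scalar_cone[of c' c] assms
    by (auto simp: add.commute)
qed

text \<open>Two opposite cones do not meet, but both meet a third one.\<close>

lemma unit_circle_chain:
  assumes "\<And>c c'. cmod c = 1 \<Longrightarrow> cmod c' = 1 \<Longrightarrow> c' \<noteq> - c \<Longrightarrow> P c \<Longrightarrow> P c'"
    and "P 1" "cmod c = 1"
  shows "P c"
proof (cases "c = -1")
  case True
  have "P \<i>" by (rule assms(1)[OF _ _ _ \<open>P 1\<close>]) (auto simp: complex_eq_iff)
  then show ?thesis unfolding True by (rule assms(1)[rotated 3]) (auto simp: complex_eq_iff)
next
  case False
  then show ?thesis using assms(1)[of 1 c] assms(2,3) by simp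
qed

text \<open>A cone is connected and consists of invertible elements, so the group contains it entirely as
  soon as it meets it. This holds for the cone around 1 and passes on along overlaps.\<close>

lemma scalar_cone_subset_open_subgroup:
  fixes G :: "'a::complex_banach_algebra_1 set"
  assumes G: "open_subgroup_of_invertibles G" and "cmod c = 1"
  shows "scalar_cone c \<subseteq> G"
proof -
  have grow: "scalar_cone c' \<subseteq> G" if "cmod c' = 1" "x \<in> scalar_cone c'" "x \<in> G" for c' x
    using G convex_connected[OF convex_scalar_cone] scalar_cone_invertible[OF that(1)] that(2,3)
    by (rule connected_subset_open_subgroup)
  show ?thesis
  proof (rule unit_circle_chain[OF _ _ \<open>cmod c = 1\<close>])
    have "1 \<in> G" using G by (simp add: open_subgroup_of_invertibles_def subgroup_of_invertibles_def)
    then show "scalar_cone 1 \<subseteq> G" using grow[of 1 1] scalar_cone_1_of_real[of 1] by simp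
  qed (use grow scalar_cone_overlap in blast)
qed

lemma open_subgroup_scaleR:
  fixes G :: "'a::complex_banach_algebra_1 set"
  assumes G: "open_subgroup_of_invertibles G" and "a \<in> G" "r > 0"
  shows "r *\<^sub>R a \<in> G"
proof -
  have sub: "subgroup_of_invertibles G" using G by (simp add: open_subgroup_of_invertibles_def)
  have "r *\<^sub>R 1 \<in> G"
    by (rule subsetD[OF scalar_cone_subset_open_subgroup[OF G, of 1] scalar_cone_1_of_real])
       (simp_all add: \<open>r > 0\<close>)
  then have "r *\<^sub>R 1 * a \<in> G"
    using \<open>a \<in> G\<close> by (rule subgroup_of_invertiblesD(3)[OF sub])
  then show ?thesis by simp
qed

section \<open>The unit is a vertex of the unit ball\<close>

text \<open>The binomial expansion, reduced to the linear coefficient. The statements on the other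
  coefficients carry the induction.\<close>

lemma power_one_plus_expansion:
  fixes x :: "'a::complex_banach_algebra_1"
  shows "\<exists>p. (n \<ge> 1 \<longrightarrow> p 1 = of_nat n * x) \<and> p 0 = 1 \<and> (\<forall>j>n. p j = 0) \<and>
    (\<forall>c. (1 + c *\<^sub>C x) ^ n = (\<Sum>j\<le>n. (c ^ j) *\<^sub>C p j))"
proof (induction n)
  case 0
  show ?case by (rule exI[of _ "\<lambda>j. if j = 0 then 1 else 0"]) simp
next
  case (Suc n)
  then obtain p where p: "n \<ge> 1 \<Longrightarrow> p 1 = of_nat n * x" "p 0 = 1" "\<And>j. j > n \<Longrightarrow> p j = 0"
    "\<And>c. (1 + c *\<^sub>C x) ^ n = (\<Sum>j\<le>n. (c ^ j) *\<^sub>C p j)" by auto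
  define q where "q j = (case j of 0 \<Rightarrow> 1 | Suc i \<Rightarrow> p j + x * p i)" for j
  have "q 1 = of_nat (Suc n) * x"
    using p(1,2) p(3)[of 1] by (cases "n = 0") (auto simp: q_def algebra_simps)
  moreover have "q j = 0" if "j > Suc n" for j
    using that p(3) by (auto simp: q_def split: nat.split)
  moreover have "(1 + c *\<^sub>C x) ^ Suc n = (\<Sum>j\<le>Suc n. (c ^ j) *\<^sub>C q j)" for c
  proof -
    have "(1 + c *\<^sub>C x) ^ Suc n
      = (\<Sum>j\<le>n. (c ^ j) *\<^sub>C p j) + (\<Sum>j\<le>n. (c ^ Suc j) *\<^sub>C (x * p j))"
      by (simp add: p(4) distrib_right sum_distrib_left mult_scaleC_left mult_scaleC_right
          scaleC_sum_right scaleC_scaleC scaleC_add_right sum.distrib mult_ac)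
    also have "(\<Sum>j\<le>n. (c ^ j) *\<^sub>C p j) = (\<Sum>j\<le>Suc n. (c ^ j) *\<^sub>C p j)"
      using p(3)[of "Suc n"] scaleC_diff_right[of _ "0::'a" 0] by simp
    also have "\<dots> = 1 + (\<Sum>j\<le>n. (c ^ Suc j) *\<^sub>C p (Suc j))"
      by (subst sum.atMost_Suc_shift) (simp add: p(2))
    also have "\<dots> + (\<Sum>j\<le>n. (c ^ Suc j) *\<^sub>C (x * p j)) = (\<Sum>j\<le>Suc n. (c ^ j) *\<^sub>C q j)"
      by (subst sum.atMost_Suc_shift) (simp add: q_def scaleC_add_right sum.distrib)
    finally show ?thesis .
  qed
  ultimately show ?case by (intro exI[of _ q]) (auto simp: q_def)
qed

text \<open>
  A Cauchy estimate: \<open>n * x\<close> is the linear coefficient of \<open>(1 + c *\<^sub>C x) ^ n\<close> as a polynomial in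
  \<open>c\<close>, and can be recovered as an average over roots of unity. The bound 1 for the polynomial
  on the unit circle gives \<open>n * norm x \<le> 1\<close> for every \<open>n\<close>.
\<close>

lemma unit_vertex:
  fixes x :: "'a::complex_banach_algebra_1"
  assumes "\<And>c. cmod c = 1 \<Longrightarrow> norm (1 + c *\<^sub>C x) \<le> 1"
  shows "x = 0"
proof -
  have bound: "n * norm x \<le> 1" if "n \<ge> 1" for n :: nat
  proof -
    obtain p where p: "p 1 = of_nat n * x"
      "\<And>c. (1 + c *\<^sub>C x) ^ n = (\<Sum>j\<le>n. (c ^ j) *\<^sub>C p j)"
      using power_one_plus_expansion[of n x] \<open>n \<ge> 1\<close> by blast
    define N where "N = n + 2"
    define \<omega> where "\<omega> k = exp (2 * of_real pi * \<i> * of_nat k / of_nat N)" for k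
    have \<omega>_power: "\<omega> k ^ m = \<omega> m ^ k" for k m
      by (simp add: \<omega>_def flip: exp_of_nat_mult) (simp add: mult_ac)
    have cmod_\<omega>: "cmod (\<omega> k) = 1" for k
      by (simp add: \<omega>_def norm_exp_eq_Re)
    have \<omega>_1: "\<omega> m = 1 \<longleftrightarrow> N dvd m" for m
      unfolding \<omega>_def by (rule complex_root_unity_eq_1) (simp add: N_def)
    \<comment> \<open>Modulo \<open>N\<close> the exponent \<open>n + 1\<close> is \<open>-1\<close>.\<close>
    have orth: "(\<Sum>k<N. \<omega> k ^ (n + 1 + j)) = (if j = 1 then of_nat N else 0)" if "j \<le> n" for j
    proof -
      define m where "m = n + 1 + j"
      have dvd: "N dvd m \<longleftrightarrow> j = 1"
      proof
        assume "N dvd m"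
        then obtain l where l: "m = N * l" by (auto simp: dvd_def)
        have "l > 0" using l by (cases l) (auto simp: m_def N_def)
        moreover have "l < 2"
        proof (rule ccontr)
          assume "\<not> l < 2"
          then have "N * 2 \<le> N * l" by (intro mult_le_mono) auto
          then show False using l \<open>j \<le> n\<close> by (simp add: m_def N_def)
        qed
        ultimately have "l = 1" by simp
        then show "j = 1" using l by (simp add: m_def N_def)
      qed (simp add: m_def N_def)
      have "(\<Sum>k<N. \<omega> k ^ m) = (\<Sum>k<N. \<omega> m ^ k)" by (simp add: \<omega>_power)
      also have "\<dots> = (if j = 1 then of_nat N else 0)"
      proof (cases "j = 1")
        case True
        then have "\<omega> m = 1" using \<omega>_1 dvd by simp
        then show ?thesis using True by simp
      next
        case False
        then have "\<omega> m \<noteq> 1" using \<omega>_1 dvd by simp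
        moreover have "\<omega> m ^ N = 1" using \<omega>_power[of m N] \<omega>_1[of N] by simp
        ultimately show ?thesis using False by (simp add: geometric_sum)
      qed
      finally show ?thesis by (simp add: m_def)
    qed
    have "(\<Sum>k<N. (\<omega> k ^ (n + 1)) *\<^sub>C (1 + \<omega> k *\<^sub>C x) ^ n)
      = (\<Sum>k<N. \<Sum>j\<le>n. (\<omega> k ^ (n + 1 + j)) *\<^sub>C p j)"
      by (simp only: p(2) scaleC_sum_right scaleC_scaleC power_add)
    also have "\<dots> = (\<Sum>j\<le>n. (\<Sum>k<N. \<omega> k ^ (n + 1 + j)) *\<^sub>C p j)"
      by (subst sum.swap) (simp add: scaleC_sum_left)
    also have "\<dots> = (\<Sum>j\<le>n. if j = 1 then of_nat N *\<^sub>C p j else 0)"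
    proof (rule sum.cong[OF refl])
      fix j assume "j \<in> {..n}"
      then have "j \<le> n" by simp
      show "(\<Sum>k<N. \<omega> k ^ (n + 1 + j)) *\<^sub>C p j = (if j = 1 then of_nat N *\<^sub>C p j else 0)"
        unfolding orth[OF \<open>j \<le> n\<close>] using scaleC_diff_left[of 0 0 "p j"] by simp
    qed
    also have "\<dots> = of_nat N *\<^sub>C p 1" using \<open>n \<ge> 1\<close> by simp
    finally have "of_nat N *\<^sub>C p 1 = (\<Sum>k<N. (\<omega> k ^ (n + 1)) *\<^sub>C (1 + \<omega> k *\<^sub>C x) ^ n)" ..
    then have "real N * norm (p 1) = norm (\<Sum>k<N. (\<omega> k ^ (n + 1)) *\<^sub>C (1 + \<omega> k *\<^sub>C x) ^ n)"
      by (metis norm_scaleC norm_of_nat)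
    also have "\<dots> \<le> (\<Sum>k<N. 1)"
    proof (rule order_trans[OF norm_sum sum_mono])
      fix k
      have "norm ((1 + \<omega> k *\<^sub>C x) ^ n) \<le> norm (1 + \<omega> k *\<^sub>C x) ^ n" by (rule norm_power_ineq)
      also have "\<dots> \<le> 1" using assms[OF cmod_\<omega>] by (intro power_le_one) auto
      finally show "norm ((\<omega> k ^ (n + 1)) *\<^sub>C (1 + \<omega> k *\<^sub>C x) ^ n) \<le> 1"
        by (simp add: norm_scaleC norm_power norm_mult cmod_\<omega>)
    qed
    finally have "norm (p 1) \<le> 1" by (simp add: N_def)
    moreover have "p 1 = real n *\<^sub>R x" using p(1) by (simp add: scaleR_conv_of_real)
    ultimately show ?thesis by simp
  qed
  show ?thesis
  proof (rule ccontr)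
    assume "x \<noteq> 0"
    then obtain n :: nat where "1 < n * norm x" using reals_Archimedean3[of "norm x"] by auto
    moreover from this have "n \<ge> 1" by (cases n) auto
    ultimately show False using bound[of n] by simp
  qed
qed

section \<open>Additive isometries on cones\<close>

text \<open>The difference \<open>f (t *\<^sub>R x) - t *\<^sub>R f x\<close> is additive in \<open>t\<close> and vanishes for integers \<open>t\<close>.
  Hence it is periodic, so that its bound on \<open>[0, 1)\<close> holds everywhere, and a bounded additive
  function is 0.\<close>

lemma additive_isometry_linear:
  fixes f :: "'a::real_normed_vector \<Rightarrow> 'b::real_normed_vector"
  assumes add: "\<And>x y. f (x + y) = f x + f y"
    and nrm: "\<And>x. norm (f x) = norm x"
  shows "linear f"
proof (rule linearI[OF add])
  fix r x
  define g where "g t = f (t *\<^sub>R x) - t *\<^sub>R f x" for t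
  have g_add: "g (s + t) = g s + g t" for s t by (simp add: g_def add scaleR_add_left)
  have g_nat: "g (of_nat n * t) = of_nat n *\<^sub>R g t" for n t
  proof (induction n)
    case 0
    have "g 0 = 0" using g_add[of 0 0] by simp
    then show ?case by simp
  next
    case (Suc n)
    then show ?case using g_add[of t "of_nat n * t"] by (simp add: algebra_simps)
  qed
  have g_int: "g (of_int i) = 0" for i
  proof -
    have "g 1 = 0" by (simp add: g_def)
    then have nat: "g (of_nat n) = 0" for n using g_nat[of n 1] by simp
    moreover have "g (- of_nat n) = 0" for n
      using g_add[of "- of_nat n" "of_nat n"] nat[of n] nat[of 0] by simp
    ultimately show ?thesis by (cases i rule: int_cases2) auto
  qed
  have g_bound: "norm (g t) \<le> 2 * norm x" for t
  proof -
    have "g t = g (frac t)"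
      using g_add[of "frac t" "of_int \<lfloor>t\<rfloor>"] g_int by (simp add: frac_def)
    also have "norm \<dots> \<le> norm (f (frac t *\<^sub>R x)) + norm (frac t *\<^sub>R f x)"
      unfolding g_def by (rule norm_triangle_ineq4)
    also have "\<dots> = 2 * (frac t * norm x)" by (simp add: nrm frac_ge_0)
    also have "\<dots> \<le> 2 * norm x" using frac_lt_1[of t] by (simp add: mult_left_le_one_le frac_ge_0)
    finally show ?thesis .
  qed
  have "g r = 0"
  proof (rule ccontr)
    assume "g r \<noteq> 0"
    then obtain n :: nat where "2 * norm x < of_nat n * norm (g r)"
      using reals_Archimedean3[of "norm (g r)"] by auto
    then show False using g_bound[of "of_nat n * r"] by (simp add: g_nat)
  qed
  then show "f (r *\<^sub>R x) = r *\<^sub>R f x" by (simp add: g_def)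
qed

text \<open>The extension is \<open>f (x + c) - f c\<close>, for any \<open>c\<close> such that \<open>c\<close> and \<open>x + c\<close> are in \<open>C\<close>.\<close>

lemma additive_isometry_extends:
  fixes f :: "'a::real_normed_vector \<Rightarrow> 'b::real_normed_vector"
  assumes C_add: "\<And>x y. x \<in> C \<Longrightarrow> y \<in> C \<Longrightarrow> x + y \<in> C"
    and C_gen: "\<And>x. \<exists>c\<in>C. x + c \<in> C"
    and add: "\<And>x y. x \<in> C \<Longrightarrow> y \<in> C \<Longrightarrow> f (x + y) = f x + f y"
    and iso: "\<And>x y. x \<in> C \<Longrightarrow> y \<in> C \<Longrightarrow> norm (f x - f y) = norm (x - y)"
  obtains L where "linear L" "\<And>x. norm (L x) = norm x" "\<And>x. x \<in> C \<Longrightarrow> L x = f x"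
proof -
  define k where "k x = (SOME c. c \<in> C \<and> x + c \<in> C)" for x
  define L where "L x = f (x + k x) - f (k x)" for x
  have k: "k x \<in> C" "x + k x \<in> C" for x
    using someI_ex[of "\<lambda>c. c \<in> C \<and> x + c \<in> C"] C_gen[of x] by (auto simp: k_def)
  have L: "L x = f (x + c) - f c" if "c \<in> C" "x + c \<in> C" for x c
  proof -
    have "f (x + k x) + f c = f (x + c) + f (k x)"
      using add[OF k(2) that(1), of x] add[OF that(2) k(1), of x] by (simp add: ac_simps)
    then show ?thesis by (simp add: L_def algebra_simps)
  qed
  have "L (x + y) = L x + L y" for x y
  proof -
    have "(x + y) + (k x + k y) = (x + k x) + (y + k y)" by (simp add: ac_simps)
    then have "L (x + y) = f ((x + k x) + (y + k y)) - f (k x + k y)"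
      using L[of "k x + k y" "x + y"] k C_add by metis
    then show ?thesis using k by (simp add: add L_def)
  qed
  moreover have "norm (L x) = norm x" for x
    using iso[OF k(2) k(1), of x x] by (simp add: L_def)
  ultimately have "linear L" by (rule additive_isometry_linear)
  moreover have "L x = f x" if "x \<in> C" for x
    using that L[of x x] C_add add by simp
  ultimately show ?thesis using \<open>\<And>x. norm (L x) = norm x\<close> that by blast
qed

lemma open_contains_small_step:
  fixes z x :: "'a::real_normed_vector"
  assumes "open S" "z \<in> S"
  obtains t where "t > 0" "z + t *\<^sub>R x \<in> S"
proof -
  have "((\<lambda>t. z + t *\<^sub>R x) \<longlongrightarrow> z + 0 *\<^sub>R x) (at_right 0)" by (intro tendsto_intros)
  then have "\<forall>\<^sub>F t in at_right 0. z + t *\<^sub>R x \<in> S"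
    using assms by (auto dest: topological_tendstoD)
  then have "\<forall>\<^sub>F t in at_right 0. t > 0 \<and> z + t *\<^sub>R x \<in> S"
    using eventually_at_right_less[of "0::real"] by eventually_elim simp
  then have "\<exists>t. t > 0 \<and> z + t *\<^sub>R x \<in> S"
    by (rule eventually_happens'[rotated]) simp
  then show ?thesis using that by blast
qed

lemma linear_eq_if_eq_on_open:
  fixes L :: "'a::real_normed_vector \<Rightarrow> 'b::real_vector"
  assumes "linear L" "linear L'" "open S" "S \<noteq> {}" and eq: "\<And>x. x \<in> S \<Longrightarrow> L x = L' x"
  shows "L = L'"
proof
  fix x :: 'a
  obtain z where "z \<in> S" using assms(4) by auto
  then obtain t where t: "t > 0" "z + t *\<^sub>R x \<in> S"
    using open_contains_small_step[OF assms(3)] by metis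
  then have "L z + t *\<^sub>R L x = L' z + t *\<^sub>R L' x"
    using eq assms(1,2) by (metis linear_add linear_scale)
  then show "L x = L' x" using eq[OF \<open>z \<in> S\<close>] t(1) by simp
qed

lemma linear_surj_if_contains_open:
  fixes L :: "'a::real_vector \<Rightarrow> 'b::real_normed_vector"
  assumes "linear L" "open S" "S \<noteq> {}" "S \<subseteq> range L"
  shows "surj L"
  unfolding surj_def
proof
  fix y :: 'b
  obtain z where "z \<in> S" using assms(3) by auto
  then obtain t where "t > 0" "z + t *\<^sub>R y \<in> S"
    using open_contains_small_step[OF assms(2)] by metis
  then have "z \<in> range L" "z + t *\<^sub>R y \<in> range L" using \<open>z \<in> S\<close> assms(4) by auto
  then obtain p q where pq: "L p = z" "L q = z + t *\<^sub>R y" unfolding image_iff by metis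
  have "L ((1/t) *\<^sub>R (q - p)) = (1/t) *\<^sub>R (L q - L p)"
    using assms(1) by (simp add: linear_scale linear_diff)
  also have "\<dots> = y" using \<open>t > 0\<close> by (simp add: pq)
  finally show "\<exists>x. y = L x" by (intro exI) (rule sym)
qed

section \<open>A criterion for membership in the radical\<close>

text \<open>
  If \<open>u\<close> were outside a maximal left ideal \<open>M\<close>, then \<open>M\<close> and \<open>u\<close> would generate the whole ring,
  so that some \<open>1 - b * u\<close> would be in \<open>M\<close>, a proper ideal.
\<close>

lemma jacobson_radicalI:
  fixes u :: "'a::ring_1"
  assumes inv: "\<And>b. 1 + b * u \<in> invertibles"
  shows "u \<in> jacobson_radical"
  unfolding jacobson_radical_def
proof safe
  fix M :: "'a set" assume M: "maximal_left_ideal M"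
  then have idl: "left_ideal M" and "M \<noteq> UNIV" by (auto simp: maximal_left_ideal_def)
  then have add: "x + y \<in> M" and mul: "r * x \<in> M" if "x \<in> M" "y \<in> M" for r x y
    using that by (auto simp: left_ideal_def)
  define J where "J = {m + b * u | m b. m \<in> M}"
  show "u \<in> M"
  proof (rule ccontr)
    assume "u \<notin> M"
    have zero: "0 \<in> M" using idl by (simp add: left_ideal_def)
    have J: "m + b * u \<in> J" if "m \<in> M" for m b using that unfolding J_def by blast
    have "left_ideal J"
      unfolding left_ideal_def
    proof (intro conjI ballI allI)
      show "0 \<in> J" using J[OF zero, of 0] by simp
    next
      fix x y assume "x \<in> J" "y \<in> J"
      then obtain m b m' b' where "x = m + b * u" "m \<in> M" "y = m' + b' * u" "m' \<in> M"
        by (auto simp: J_def)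
      moreover from this have "x + y = (m + m') + (b + b') * u" by (simp only: ac_simps distrib_right)
      ultimately show "x + y \<in> J" by (simp only: J add)
    next
      fix r x assume "x \<in> J"
      then obtain m b where "x = m + b * u" "m \<in> M" by (auto simp: J_def)
      moreover from this have "r * x = r * m + (r * b) * u" by (simp add: algebra_simps)
      ultimately show "r * x \<in> J" by (simp only: J mul)
    qed
    moreover have "M \<subseteq> J" using J[of _ 0] by auto
    moreover have "u \<in> J" using J[OF zero, of 1] by simp
    ultimately have "J = UNIV" using M \<open>u \<notin> M\<close> by (auto simp: maximal_left_ideal_def)
    then obtain m b where mb: "1 = m + b * u" "m \<in> M" unfolding J_def by blast
    then have "m = 1 + (- b) * u" by (simp add: algebra_simps)
    then obtain m' where "m' * m = 1" using inv[of "- b"] by (auto simp: invertibles_def)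
    then have "1 \<in> M" using mul[OF mb(2) mb(2), of m'] by simp
    then have "r \<in> M" for r using mul[of 1 1 r] by simp
    then show False using \<open>M \<noteq> UNIV\<close> by auto
  qed
qed

text \<open>
  Translation invariance under \<open>u\<close> spreads to \<open>h * u\<close> for \<open>h\<close> in \<open>H\<close>, by factoring out \<open>h\<close>, and
  every \<open>b\<close> is the sum of two elements of \<open>H\<close>.
\<close>

lemma translation_invariant_imp_radical:
  fixes H :: "'b::complex_banach_algebra_1 set"
  assumes H: "open_subgroup_of_invertibles H" and trans: "\<And>h. h \<in> H \<Longrightarrow> h + u \<in> H"
  shows "u \<in> jacobson_radical"
proof (rule jacobson_radicalI)
  fix b :: 'b
  have sub: "subgroup_of_invertibles H" using H by (simp add: open_subgroup_of_invertibles_def)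
  note subD = subgroup_of_invertiblesD[OF sub]
  have step: "k + h * u \<in> H" if kh: "k \<in> H" "h \<in> H" for k h
  proof -
    obtain h' where h': "h' \<in> H" "h * h' = 1" using kh(2) subgroup_of_invertibles_inverse[OF sub] by blast
    have "h * (h' * k + u) \<in> H" using h' kh by (intro subD(3) trans)
    then show ?thesis by (simp add: distrib_left h'(2) flip: mult.assoc)
  qed
  define r where "r = norm b + 1"
  have "norm b < r" "norm (0::'b) < r" by (simp_all add: r_def add_nonneg_pos)
  then have "b + r *\<^sub>R 1 *\<^sub>C 1 \<in> scalar_cone 1" "0 + r *\<^sub>R (-1) *\<^sub>C 1 \<in> (scalar_cone (-1) :: 'b set)"
    by (blast intro: add_scalar_in_scalar_cone)+
  then have "b + r *\<^sub>R 1 \<in> H" "- (r *\<^sub>R 1) \<in> H"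
    using scalar_cone_subset_open_subgroup[OF H, of 1] scalar_cone_subset_open_subgroup[OF H, of "-1"]
    by (auto simp: scaleC_minus_left)
  then have "1 + (b + r *\<^sub>R 1) * u + (- (r *\<^sub>R 1)) * u \<in> H"
    by (intro step subD(2))
  moreover have "1 + (b + r *\<^sub>R 1) * u + (- (r *\<^sub>R 1)) * u = 1 + b * u"
    by (simp add: algebra_simps)
  ultimately have "1 + b * u \<in> H" by metis
  then show "1 + b * u \<in> invertibles" using subD(1) by blast
qed

section \<open>Isometries between open subgroups\<close>

text \<open>The limit of \<open>T\<close> at 0 exists by completeness, since 0 is in the closure of the subgroup.\<close>

lemma isometry_value_at_zero:
  fixes T :: "'a::complex_banach_algebra_1 \<Rightarrow> 'b::banach"
  assumes G: "open_subgroup_of_invertibles G"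
    and iso: "\<And>a b. a \<in> G \<Longrightarrow> b \<in> G \<Longrightarrow> norm (T a - T b) = norm (a - b)"
  obtains u where "\<And>a. a \<in> G \<Longrightarrow> norm (T a - u) = norm a"
proof -
  define z :: "nat \<Rightarrow> 'a" where "z n = inverse (real (Suc n)) *\<^sub>R 1" for n
  have z: "z n \<in> G" for n
    using scalar_cone_subset_open_subgroup[OF G, of 1] scalar_cone_1_of_real[of "inverse (real (Suc n))"]
    by (auto simp: z_def)
  have z0: "z \<longlonglongrightarrow> 0"
    using tendsto_scaleR[OF LIMSEQ_inverse_real_of_nat tendsto_const, of "1::'a"]
    by (simp add: z_def[abs_def])
  then have "Cauchy z" by (rule LIMSEQ_imp_Cauchy)
  then have "Cauchy (\<lambda>n. T (z n))" using z iso by (simp add: Cauchy_def dist_norm)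
  then obtain u where u: "(\<lambda>n. T (z n)) \<longlonglongrightarrow> u" using Cauchy_convergent_iff convergent_def by blast
  have "norm (T a - u) = norm a" if "a \<in> G" for a
  proof -
    have "(\<lambda>n. norm (T a - T (z n))) \<longlonglongrightarrow> norm (T a - u)" by (intro tendsto_intros u)
    moreover have "(\<lambda>n. norm (T a - T (z n))) \<longlonglongrightarrow> norm (a - 0)"
      unfolding iso[OF that z] by (intro tendsto_intros z0)
    ultimately have "norm (T a - u) = norm (a - 0)" by (rule LIMSEQ_unique)
    then show ?thesis by simp
  qed
  then show ?thesis using that by blast
qed

text \<open>The assumption on \<open>u\<close> says that \<open>T\<close> remains an isometry when extended by \<open>T 0 = u\<close>.\<close>

locale subgroup_isometry =
  fixes G :: "'a::complex_banach_algebra_1 set" and H :: "'b::complex_banach_algebra_1 set"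
    and T :: "'a \<Rightarrow> 'b" and u :: 'b
  assumes G: "open_subgroup_of_invertibles G"
    and H: "open_subgroup_of_invertibles H"
    and image: "T ` G = H"
    and iso: "\<And>a b. a \<in> G \<Longrightarrow> b \<in> G \<Longrightarrow> norm (T a - T b) = norm (a - b)"
    and norm_T_diff_u: "\<And>a. a \<in> G \<Longrightarrow> norm (T a - u) = norm a"
begin

lemma cone_subset: "cmod c = 1 \<Longrightarrow> scalar_cone c \<subseteq> G"
  using G by (rule scalar_cone_subset_open_subgroup)

lemma T_midpoint:
  assumes "closed_segment x y \<subseteq> G"
  shows "T (midpoint x y) = midpoint (T x) (T y)"
proof (rule isometry_midpoint[where U = G])
  show "open G" "open (T ` G)"
    using open_subgroup_openD[OF G] open_subgroup_openD[OF H] image by simp_all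
  show "dist (T a) (T b) = dist a b" if "a \<in> G" "b \<in> G" for a b
    using that by (simp add: dist_norm iso)
qed (rule assms)

text \<open>The midpoint law for 0 and \<open>a\<close>, obtained from that for \<open>t *\<^sub>R a\<close> and \<open>a\<close> as \<open>t\<close> tends to 0.\<close>

lemma T_half:
  assumes "a \<in> G"
  shows "T ((1/2) *\<^sub>R a) = (1/2) *\<^sub>R (u + T a)"
proof (rule ccontr)
  assume neq: "\<not> ?thesis"
  define e where "e = norm (T ((1/2) *\<^sub>R a) - (1/2) *\<^sub>R (u + T a))"
  have "e > 0" using neq by (simp add: e_def)
  have G_scale: "r *\<^sub>R a \<in> G" if "r > 0" for r
    using G \<open>a \<in> G\<close> that by (rule open_subgroup_scaleR)
  have bound: "e \<le> t * norm a" if t: "0 < t" "t \<le> 1" for t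
  proof -
    have "closed_segment (t *\<^sub>R a) a \<subseteq> G"
    proof
      fix x assume "x \<in> closed_segment (t *\<^sub>R a) a"
      then obtain s where s: "0 \<le> s" "s \<le> 1" "x = ((1 - s) * t + s) *\<^sub>R a"
        by (auto simp: in_segment algebra_simps)
      have "(1 - s) * t + s > 0"
      proof (cases "s = 0")
        case False
        then show ?thesis using s t by (intro add_nonneg_pos mult_nonneg_nonneg) auto
      qed (use t in auto)
      then show "x \<in> G" using G_scale s by blast
    qed
    have midpoint_ta: "midpoint (t *\<^sub>R a) a = ((1 + t)/2) *\<^sub>R a"
      by (simp add: midpoint_def add_divide_distrib scaleR_add_left scaleR_add_right)
    from \<open>closed_segment (t *\<^sub>R a) a \<subseteq> G\<close>
    have "T (midpoint (t *\<^sub>R a) a) = midpoint (T (t *\<^sub>R a)) (T a)" by (rule T_midpoint)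
    then have mid: "T (((1 + t)/2) *\<^sub>R a) = (1/2) *\<^sub>R (T (t *\<^sub>R a) + T a)"
      using midpoint_ta by (simp add: midpoint_def)
    have "T ((1/2) *\<^sub>R a) - (1/2) *\<^sub>R (u + T a)
        = (T ((1/2) *\<^sub>R a) - T (((1 + t)/2) *\<^sub>R a)) + (1/2) *\<^sub>R (T (t *\<^sub>R a) - u)"
      by (simp add: mid algebra_simps)
    then have "e \<le> norm (T ((1/2) *\<^sub>R a) - T (((1 + t)/2) *\<^sub>R a)) + norm ((1/2) *\<^sub>R (T (t *\<^sub>R a) - u))"
      unfolding e_def by (metis norm_triangle_ineq)
    also have "norm (T ((1/2) *\<^sub>R a) - T (((1 + t)/2) *\<^sub>R a)) = norm ((1/2 - (1 + t)/2) *\<^sub>R a)"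
      using G_scale t by (subst iso) (auto simp: scaleR_diff_left)
    also have "\<dots> = t / 2 * norm a" using t by (simp add: add_divide_distrib)
    also have "norm ((1/2) *\<^sub>R (T (t *\<^sub>R a) - u)) = t / 2 * norm a"
      using t by (simp add: norm_T_diff_u G_scale)
    finally show ?thesis by simp
  qed
  obtain n :: nat where n: "norm a < n * e" using reals_Archimedean3[OF \<open>e > 0\<close>] by auto
  have "e \<le> 1 / (real n + 1) * norm a" by (rule bound) auto
  then have "(real n + 1) * e \<le> norm a" by (simp add: field_simps)
  then show False using n \<open>e > 0\<close> by (simp add: algebra_simps)
qed

text \<open>For \<open>h = T a\<close> the point \<open>T ((1/2) *\<^sub>R a) = (1/2) *\<^sub>R (u + h)\<close> is in \<open>H\<close>, and so is its double.\<close>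

lemma u_in_radical: "u \<in> jacobson_radical"
  using H
proof (rule translation_invariant_imp_radical)
  fix h assume "h \<in> H"
  then obtain a where a: "a \<in> G" "h = T a" using image by auto
  then have "(1/2) *\<^sub>R a \<in> G" using G by (intro open_subgroup_scaleR) auto
  then have "T ((1/2) *\<^sub>R a) \<in> H" using image by blast
  then have "(1/2) *\<^sub>R (u + h) \<in> H" unfolding T_half[OF a(1)] a(2) .
  then show "h + u \<in> H" using open_subgroup_scaleR[OF H, of _ 2] by (force simp: add.commute)
qed

text \<open>The midpoint law for \<open>x\<close> and \<open>y\<close>, combined with that for 0 and \<open>x + y\<close>.\<close>

lemma T_add_on_cone:
  assumes "cmod c = 1" "x \<in> scalar_cone c" "y \<in> scalar_cone c"
  shows "T (x + y) - u = (T x - u) + (T y - u)"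
proof -
  have "closed_segment x y \<subseteq> G"
    using assms cone_subset convex_scalar_cone closed_segment_subset by blast
  then have "(1/2) *\<^sub>R (T x + T y) = T ((1/2) *\<^sub>R (x + y))"
    using T_midpoint by (simp add: midpoint_def)
  also have "\<dots> = (1/2) *\<^sub>R (u + T (x + y))"
    using assms scalar_cone_add cone_subset by (intro T_half) blast
  finally have "T x + T y = u + T (x + y)" by simp
  then show ?thesis by (simp add: algebra_simps)
qed

lemma linear_on_cone:
  assumes "cmod c = 1"
  shows "\<exists>L. linear L \<and> (\<forall>x. norm (L x) = norm x) \<and> (\<forall>x\<in>scalar_cone c. T x = L x + u)"
proof -
  have gen: "\<exists>y\<in>scalar_cone c. x + y \<in> scalar_cone c" for x :: 'a
  proof (rule bexI)
    show "x + (norm x + 1) *\<^sub>R c *\<^sub>C 1 \<in> scalar_cone c" by (rule add_scalar_in_scalar_cone) simp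
    have "0 + (norm x + 1) *\<^sub>R c *\<^sub>C 1 \<in> (scalar_cone c :: 'a set)"
      by (rule add_scalar_in_scalar_cone) (simp add: add_nonneg_pos)
    then show "(norm x + 1) *\<^sub>R c *\<^sub>C 1 \<in> (scalar_cone c :: 'a set)" by simp
  qed
  have cone_iso: "norm ((T x - u) - (T y - u)) = norm (x - y)"
    if "x \<in> scalar_cone c" "y \<in> scalar_cone c" for x y
    using iso[of x y] that cone_subset[OF assms] by auto
  obtain L where "linear L" "\<And>x. norm (L x) = norm x" "\<And>x. x \<in> scalar_cone c \<Longrightarrow> L x = T x - u"
    using additive_isometry_extends[OF scalar_cone_add gen T_add_on_cone[OF assms] cone_iso] by blast
  then show ?thesis by (intro exI[of _ L]) simp
qed

text \<open>
  The linear maps belonging to two overlapping cones agree on the overlap, which is open, and are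
  therefore equal. The common map is surjective because its range contains a neighbourhood of
  \<open>T 1 - u\<close>: the preimages of the points near \<open>T 1\<close> are near 1, hence in the cone around 1.
\<close>

lemma linear_on_cones:
  obtains L where "linear L" "surj L" "\<And>x. norm (L x) = norm x"
    "\<And>c x. cmod c = 1 \<Longrightarrow> x \<in> scalar_cone c \<Longrightarrow> T x = L x + u"
proof -
  obtain L where L: "linear L" "\<And>x. norm (L x) = norm x" "\<And>x. x \<in> scalar_cone 1 \<Longrightarrow> T x = L x + u"
    using linear_on_cone[of 1] by auto
  have cones: "\<forall>x\<in>scalar_cone c. T x = L x + u" if "cmod c = 1" for c
  proof (rule unit_circle_chain[OF _ _ that])
    fix c c' :: complex
    assume c: "cmod c = 1" "cmod c' = 1" "c' \<noteq> - c" and eq: "\<forall>x\<in>scalar_cone c. T x = L x + u"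
    obtain L' where L': "linear L'" "\<forall>x\<in>scalar_cone c'. T x = L' x + u"
      using linear_on_cone[OF c(2)] by blast
    have "L = L'"
      using L(1) L'(1) open_Int[OF open_scalar_cone open_scalar_cone] scalar_cone_overlap[OF c]
      by (rule linear_eq_if_eq_on_open) (metis IntE L'(2) add_right_cancel eq)
    then show "\<forall>x\<in>scalar_cone c'. T x = L x + u" using L'(2) by simp
  qed (use L(3) in simp)
  have "surj L"
  proof -
    have "1 \<in> G" using G by (simp add: open_subgroup_of_invertibles_def subgroup_of_invertiblesD(2))
    then obtain \<rho> where \<rho>: "\<rho> > 0" "ball (T 1) \<rho> \<subseteq> H"
      using open_subgroup_openD[OF H] image open_contains_ball by blast
    have "ball (T 1 - u) (min \<rho> 1) \<subseteq> range L"
    proof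
      fix y assume y: "y \<in> ball (T 1 - u) (min \<rho> 1)"
      then have y': "norm (T 1 - (y + u)) < min \<rho> 1" by (simp add: dist_norm algebra_simps)
      then have "y + u \<in> H" using \<rho>(2) by (auto simp: dist_norm)
      then obtain x where x: "x \<in> G" "y + u = T x" using image by auto
      then have "norm (x - 1) < 1" using y' iso[of 1 x] \<open>1 \<in> G\<close> by (simp add: norm_minus_commute)
      then have "x \<in> scalar_cone 1" using add_scalar_in_scalar_cone[of "x - 1" 1 1] by simp
      then have "y = L x" using L(3) x(2) by (metis add_right_cancel)
      then show "y \<in> range L" by simp
    qed
    moreover have "ball (T 1 - u) (min \<rho> 1) \<noteq> {}" using \<rho>(1) by simp
    ultimately show ?thesis using linear_surj_if_contains_open[OF L(1) open_ball] by blast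
  qed
  then show ?thesis using that L(1,2) cones by blast
qed

text \<open>
  Take \<open>a\<close> in \<open>G\<close> and let \<open>L b = T a - u\<close>. The points at distance \<open>t\<close> from \<open>a\<close> of the form
  \<open>a + t *\<^sub>R c *\<^sub>C 1\<close> with large \<open>t\<close> lie in the cones, where \<open>T\<close> is already known, so \<open>b\<close> has the
  same distance \<open>t\<close> from each of them. As 1 is a vertex of the unit ball, \<open>b = a\<close>.
\<close>

lemma linear_on_group:
  obtains L where "linear L" "surj L" "\<And>x. norm (L x) = norm x" "\<And>a. a \<in> G \<Longrightarrow> T a = L a + u"
proof -
  obtain L where L: "linear L" "surj L" "\<And>x. norm (L x) = norm x"
    "\<And>c x. cmod c = 1 \<Longrightarrow> x \<in> scalar_cone c \<Longrightarrow> T x = L x + u"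
    using linear_on_cones by blast
  have "T a = L a + u" if "a \<in> G" for a
  proof -
    obtain b where b: "L b = T a - u" using L(2) by (metis surjD)
    define t where "t = norm a + 1"
    have t: "t > 0" "norm a < t" by (auto simp: t_def add_nonneg_pos)
    define d where "d = - ((1/t) *\<^sub>R (b - a))"
    have td: "t *\<^sub>R d = a - b" using t(1) by (simp add: d_def)
    have "d = 0"
    proof (rule unit_vertex)
      fix c :: complex assume c: "cmod c = 1"
      define x where "x = a + t *\<^sub>R inverse c *\<^sub>C 1"
      have "c \<noteq> 0" using c by auto
      then have c': "cmod (inverse c) = 1" "inverse c * c = 1" using c by (simp_all add: norm_inverse)
      have "x \<in> scalar_cone (inverse c)" unfolding x_def using t(2) by (rule add_scalar_in_scalar_cone)
      then have x: "T x = L x + u" "x \<in> G" using L(4) c'(1) cone_subset by auto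
      have "b - x = (- t) *\<^sub>R inverse c *\<^sub>C (1 + c *\<^sub>C d)"
        by (simp add: x_def scaleC_add_right scaleC_scaleC c'(2) scaleR_add_right td)
      then have "t * norm (1 + c *\<^sub>C d) = norm (b - x)"
        using t(1) c'(1) by (simp add: norm_scaleC)
      also have "\<dots> = norm (L b - L x)" using L(1,3) by (metis linear_diff)
      also have "\<dots> = norm (T a - T x)" by (simp add: b x(1) algebra_simps)
      also have "\<dots> = norm (a - x)" using that x(2) by (rule iso)
      also have "\<dots> = t" using t(1) c'(1) by (simp add: x_def norm_scaleC)
      finally show "norm (1 + c *\<^sub>C d) \<le> 1" using t(1) by simp
    qed
    then have "b = a" using t(1) by (simp add: d_def)
    then show ?thesis using b by simp
  qed
  then show ?thesis using that L(1-3) by blast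
qed

end

theorem theorem3p2:
  fixes \<AA> :: "'a::complex_banach_algebra_1 set"
    and \<BB> :: "'b::complex_banach_algebra_1 set"
    and T :: "'a \<Rightarrow> 'b"
  assumes "open_subgroup_of_invertibles \<AA>"
    and "open_subgroup_of_invertibles \<BB>"
    and "T ` \<AA> = \<BB>"
    and "\<And>a b. a \<in> \<AA> \<Longrightarrow> b \<in> \<AA> \<Longrightarrow> norm (T a - T b) = norm (a - b)"
  shows "\<exists>(T\<^sub>0 :: 'a \<Rightarrow> 'b) u\<^sub>0.
    linear T\<^sub>0 \<and> surj T\<^sub>0 \<and> (\<forall>x y. norm (T\<^sub>0 x - T\<^sub>0 y) = norm (x - y)) \<and>
    u\<^sub>0 \<in> jacobson_radical \<and> (\<forall>a\<in>\<AA>. T a = T\<^sub>0 a + u\<^sub>0)"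
proof -
  obtain u where "\<And>a. a \<in> \<AA> \<Longrightarrow> norm (T a - u) = norm a"
    using isometry_value_at_zero[OF assms(1,4)] by blast
  then interpret subgroup_isometry \<AA> \<BB> T u
    using assms by unfold_locales
  obtain L where L: "linear L" "surj L" "\<And>x. norm (L x) = norm x" "\<And>a. a \<in> \<AA> \<Longrightarrow> T a = L a + u"
    using linear_on_group by blast
  have "norm (L x - L y) = norm (x - y)" for x y
    using L(1,3) by (metis linear_diff)
  then show ?thesis using L u_in_radical by blast
qed

end
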